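(* Fix $\alpha\in(0,1)$ and $\kappa>0$, and let $\mathcal X$ be a measurable space containing two distinct points whose singleton sets are measurable. Then there exist probability measures $P_X,Q_X$ on $\mathcal X$ (source and target marginals), a reference conditional kernel $P^0_{Y\mid X}$ from $\mathcal X$ to $\mathbb R$, and a reference score $S^\star:\mathcal X\times\mathbb R\to\mathbb R$, all independent of $m$, such that: (i) $Q_X\ll P_X$, the likelihood ratio $w=dQ_X/dP_X$ is bounded by a finite constant, and $\chi^2(Q_X\Vert P_X)=\kappa$; (ii) $P^0_{Y\mid X}$ satisfies mass regularity (see context) on a measurable set of full $P_X$-measure; (iii) $S^\star$ is the equal-tailed oracle CQR score under $P^0_{Y\mid X}$; and the following holds. For $m\ge1$ and $p\in[1,\infty]$ define, with $S^\star$, $P_X$, $Q_X$ held fixed, $$\mathcal R_{m,p}=\inf_{\widehat q}\;\sup_{P_{Y\mid X}}\;\mathbb E_{(P_X\otimes P_{Y\mid X})^{\otimes m}}\Bigl[\bigl\|\mathrm{Cov}^P_{\{S^\star\le\widehat q\}}(\cdot)-(1-\alpha)\bigr\|_{L^p(Q_X)}\Bigr],$$ where the infimum is over scalar threshold rules and the supremum over admissible conditional kernels (see context). Set $$m_\star=\left\lceil\frac{4(\log2)(1+\kappa)\,\alpha(1-\alpha)}{\min\{\alpha,1-\alpha\}^2}\right\rceil .$$ Then for every integer $m\ge m_\star$ and every $p\in[1,\infty]$, $$\mathcal R_{m,p}\ge c_\alpha\sqrt{\frac{1+\kappa}{m}},\qquad c_\alpha=\frac18\sqrt{(\log2)\,\alpha(1-\alpha)}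 .$$
   Context: $\chi^2(Q_X\Vert P_X)=\int(w-1)^2\,dP_X$ with $w=dQ_X/dP_X$. Quantiles: for a kernel $P_{Y\mid X}$ and $\tau\in(0,1)$, $f_\tau(x)=\inf\{t\in\mathbb R:P_{Y\mid X=x}((-\infty,t])\ge\tau\}$. The equal-tailed oracle CQR score under $P^0_{Y\mid X}$ is $S^\star(x,y)=\max\{f^0_{\alpha/2}(x)-y,\;y-f^0_{1-\alpha/2}(x)\}$ with $f^0_\tau$ the conditional quantiles of $P^0_{Y\mid X}$. Mass regularity of a kernel $P_{Y\mid X}$ on a set $\mathcal X_0$: there are constants $0<\mu_{\rm low}\le\mu_{\rm up}<\infty$ and $r_0>0$ such that for every $x\in\mathcal X_0$: $P_{Y\mid X=x}([u,v])\le\mu_{\rm up}(v-u)$ for all finite $u\le v$; and for $\tau\in\{\alpha/2,1-\alpha/2\}$, $0\le h\le r_0$, $P_{Y\mid X=x}([f_\tau(x)-h,f_\tau(x)])\ge\mu_{\rm low}h$ and $P_{Y\mid X=x}([f_\tau(x),f_\tau(x)+h])\ge\mu_{\rm low}h$. Admissible kernels: all conditional kernels $P_{Y\mid X}$ from $\mathcal X$ to $\mathbb R$ satisfying mass regularity on a measurable set of full $P_X$-measure. Scalar threshold rule: a measurable function $\widehat q$ of the $m$ source observations in $(\mathcal X\times\mathbb R)^m$ with values in $\overline{\mathbb R}=\mathbb R\cup\{\pm\infty\}$. For a realized sample, $\mathrm{Cov}^P_{\{S^\star\le\widehat q\}}(x)=P_{Y\mid X=x}(\{y:S^\star(x,y)\le\widehat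 q\})$, the sample being held fixed. *)

theory Defs
  imports "HOL-Probability.Probability" "HOL-Probability.Essential_Supremum"
begin

definition prob_kernel :: "'x measure \<Rightarrow> ('x \<Rightarrow> real measure) set" where
  "prob_kernel M = M \<rightarrow>\<^sub>M prob_algebra borel"

text \<open>The infimum is taken in \<^typ>\<open>real\<close>; for \<open>0 < \<tau> < 1\<close> and a probability measure \<open>P x\<close>
  the set is nonempty and bounded below.\<close>

definition cond_quantile :: "('x \<Rightarrow> real measure) \<Rightarrow> real \<Rightarrow> 'x \<Rightarrow> real" where
  "cond_quantile P \<tau> x = Inf {t. \<tau> \<le> measure (P x) {..t}}"

definition cqr_score :: "real \<Rightarrow> ('x \<Rightarrow> real measure) \<Rightarrow> 'x \<Rightarrow> real \<Rightarrow> real" where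
  "cqr_score \<alpha> P x y =
     max (cond_quantile P (\<alpha> / 2) x - y) (y - cond_quantile P (1 - \<alpha> / 2) x)"

definition mass_regular_on :: "real \<Rightarrow> ('x \<Rightarrow> real measure) \<Rightarrow> 'x set \<Rightarrow> bool" where
  "mass_regular_on \<alpha> P X0 \<longleftrightarrow>
     (\<exists>\<mu>low \<mu>up r0 :: real. 0 < \<mu>low \<and> \<mu>low \<le> \<mu>up \<and> 0 < r0 \<and>
       (\<forall>x\<in>X0.
          (\<forall>u v. u \<le> v \<longrightarrow> measure (P x) {u..v} \<le> \<mu>up * (v - u)) \<and>
          (\<forall>\<tau>\<in>{\<alpha> / 2, 1 - \<alpha> / 2}. \<forall>h. 0 \<le> h \<and> h \<le> r0 \<longrightarrow>
             \<mu>low * h \<le> measure (P x) {cond_quantile P \<tau> x - h..cond_quantile P \<tau> x} \<and>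
             \<mu>low * h \<le> measure (P x) {cond_quantile P \<tau> x..cond_quantile P \<tau> x + h})))"

definition mass_regular_ae :: "real \<Rightarrow> 'x measure \<Rightarrow> ('x \<Rightarrow> real measure) \<Rightarrow> bool" where
  "mass_regular_ae \<alpha> PX P \<longleftrightarrow>
     (\<exists>X0\<in>sets PX. emeasure PX X0 = 1 \<and> mass_regular_on \<alpha> P X0)"

text \<open>The regularity constants may depend on the kernel.\<close>

definition admissible_kernels :: "real \<Rightarrow> 'x measure \<Rightarrow> ('x \<Rightarrow> real measure) set" where
  "admissible_kernels \<alpha> PX = {P \<in> prob_kernel PX. mass_regular_ae \<alpha> PX P}"

text \<open>\<open>chi_square Q P\<close> is meant for finite measures with \<open>Q\<close> absolutely continuous with
  respect to \<open>P\<close>; then \<^term>\<open>RN_deriv P Q\<close>, which is the density dQ/dP, is finite almost everywhere.\<close>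

definition chi_square :: "'x measure \<Rightarrow> 'x measure \<Rightarrow> ennreal" where
  "chi_square Q P = (\<integral>\<^sup>+ x. ennreal ((enn2real (RN_deriv P Q x) - 1)\<^sup>2) \<partial>P)"

definition joint_law :: "'x measure \<Rightarrow> ('x \<Rightarrow> real measure) \<Rightarrow> ('x \<times> real) measure" where
  "joint_law PX P = PX \<bind> (\<lambda>x. P x \<bind> (\<lambda>y. return (PX \<Otimes>\<^sub>M borel) (x, y)))"

definition sample_law ::
    "nat \<Rightarrow> 'x measure \<Rightarrow> ('x \<Rightarrow> real measure) \<Rightarrow> (nat \<Rightarrow> 'x \<times> real) measure" where
  "sample_law m PX P = (\<Pi>\<^sub>M i\<in>{..<m}. joint_law PX P)"

definition threshold_rules :: "nat \<Rightarrow> 'x measure \<Rightarrow> ((nat \<Rightarrow> 'x \<times> real) \<Rightarrow> ereal) set" where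
  "threshold_rules m M = (\<Pi>\<^sub>M i\<in>{..<m}. M \<Otimes>\<^sub>M (borel :: real measure)) \<rightarrow>\<^sub>M borel"

definition coverage ::
    "('x \<Rightarrow> real measure) \<Rightarrow> ('x \<Rightarrow> real \<Rightarrow> real) \<Rightarrow> ereal \<Rightarrow> 'x \<Rightarrow> real" where
  "coverage P S q x = measure (P x) {y. ereal (S x y) \<le> q}"

definition Lp_norm :: "ennreal \<Rightarrow> 'x measure \<Rightarrow> ('x \<Rightarrow> real) \<Rightarrow> ennreal" where
  "Lp_norm p M g =
     (if p = \<infinity> then esssup M (\<lambda>x. ennreal \<bar>g x\<bar>)
      else let I = (\<integral>\<^sup>+ x. ennreal (\<bar>g x\<bar> powr enn2real p) \<partial>M)
           in if I = \<infinity> then \<infinity> else ennreal (enn2real I powr (1 / enn2real p)))"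

definition minimax_risk ::
    "real \<Rightarrow> 'x measure \<Rightarrow> 'x measure \<Rightarrow> ('x \<Rightarrow> real \<Rightarrow> real) \<Rightarrow> nat \<Rightarrow> ennreal \<Rightarrow> ennreal" where
  "minimax_risk \<alpha> PX QX S m p =
     (INF q\<in>threshold_rules m PX. SUP P\<in>admissible_kernels \<alpha> PX.
        \<integral>\<^sup>+ z. Lp_norm p QX (\<lambda>x. coverage P S (q z) x - (1 - \<alpha>)) \<partial>sample_law m PX P)"

end

theory Submission
  imports Defs
begin

text \<open>
  Put mass \<open>1 / (1 + \<kappa>)\<close> on a point \<open>x1\<close> and the rest on \<open>x2\<close>, and let the target be the Dirac
  measure at \<open>x1\<close>. Then the chi-square divergence is exactly \<open>\<kappa>\<close>, every \<open>L\<^sup>p\<close> norm under the target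
  is the absolute value at \<open>x1\<close>, so that \<open>p\<close> disappears from the problem, and only the observations
  that fall on \<open>x1\<close> are informative, a fraction \<open>1 / (1 + \<kappa>)\<close> on average. This is the source of the factor
  \<open>1 + \<kappa>\<close>.

  The reference kernel is uniform on \<open>[0, 1]\<close>, and the oracle score is nonpositive exactly on
  \<open>C = [\<alpha> / 2, 1 - \<alpha> / 2]\<close>. The two competing kernels move mass \<open>\<plusminus>d\<close> into \<open>C\<close> at \<open>x1\<close>, where
  \<open>d = sqrt (ln 2 * \<alpha> * (1 - \<alpha>) * (1 + \<kappa>) / m) / 2\<close>. A threshold \<open>q \<ge> 0\<close> accepts all of \<open>C\<close>, hence
  overcovers by at least \<open>d\<close> under the kernel with more central mass; a threshold \<open>q < 0\<close> accepts
  only points of \<open>C\<close>, hence undercovers by at least \<open>d\<close> under the kernel with less central mass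
  (\<open>coverage_spike_kernel\<close>). A threshold rule is therefore a test of the sign of the perturbation,
  the test set being the set of samples with \<open>q \<ge> 0\<close>, and it loses \<open>d\<close> whenever the test errs.

  The test cannot be good, because both sample laws are close to the reference sample law. The
  likelihood ratio of one observation has second moment
  \<open>1 + d\<^sup>2 / ((1 + \<kappa>) * \<alpha> * (1 - \<alpha>)) = 1 + ln 2 / (4 * m)\<close>, so that of the sample has second moment
  at most \<open>2 powr (1 / 4) \<le> 5 / 4\<close>. Hence each alternative gives every event at least its
  reference probability minus \<open>1 / 4\<close> (\<open>measure_PiM_density_ge\<close>). The two error probabilities add up
  to at least \<open>1 - 2 / 4\<close>, one of the two risks is at least \<open>d / 4\<close>
  (\<open>minimax_risk_spike_ge\<close>), and \<open>d / 4\<close> is the claimed bound.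

  The lower bound on \<open>m\<close> says \<open>d \<le> min \<alpha> (1 - \<alpha>) / 4\<close> (\<open>perturbation_size\<close>). It keeps the perturbed
  densities between \<open>1 / 2\<close> and \<open>3 / 2\<close>, which makes the alternatives mass regular although their
  quantiles differ from those of the reference kernel (\<open>mass_regular_on_unif_comparable\<close>).
\<close>

section \<open>Product laws with a bounded density\<close>

text \<open>
  The two sides agree on rectangles, where the integral of a product of functions of
  separate coordinates factorizes.
\<close>

lemma PiM_density:
  fixes f :: "'a \<Rightarrow> real"
  assumes J: "prob_space J" and f[measurable]: "f \<in> borel_measurable J"
    and nn: "\<And>x. 0 \<le> f x" and D: "prob_space (density J f)" and I: "finite I"
  shows "(\<Pi>\<^sub>M i\<in>I. density J f) = density (\<Pi>\<^sub>M i\<in>I. J) (\<lambda>z. ennreal (\<Prod>i\<in>I. f (z i)))"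
proof -
  interpret J: product_prob_space "\<lambda>_. J" I
    using J by (intro product_prob_spaceI)
  interpret D: product_prob_space "\<lambda>_. density J f" I
    using D by (intro product_prob_spaceI)
  have "density (\<Pi>\<^sub>M i\<in>I. J) (\<lambda>z. ennreal (\<Prod>i\<in>I. f (z i))) = (\<Pi>\<^sub>M i\<in>I. density J f)"
  proof (rule D.PiM_eqI[OF I])
    show "sets (density (\<Pi>\<^sub>M i\<in>I. J) (\<lambda>z. ennreal (\<Prod>i\<in>I. f (z i)))) = sets (\<Pi>\<^sub>M i\<in>I. density J f)"
      by (simp cong: sets_PiM_cong)
  next
    fix A assume A: "\<And>i. i \<in> I \<Longrightarrow> A i \<in> sets (density J f)"
    then have AJ: "\<And>i. i \<in> I \<Longrightarrow> A i \<in> sets J" by simp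
    have "emeasure (density (\<Pi>\<^sub>M i\<in>I. J) (\<lambda>z. ennreal (\<Prod>i\<in>I. f (z i)))) (Pi\<^sub>E I A) =
      (\<integral>\<^sup>+ z. ennreal (\<Prod>i\<in>I. f (z i)) * indicator (Pi\<^sub>E I A) z \<partial>(\<Pi>\<^sub>M i\<in>I. J))"
      using AJ I by (intro emeasure_density) auto
    also have "\<dots> = (\<integral>\<^sup>+ z. (\<Prod>i\<in>I. ennreal (f (z i)) * indicator (A i) (z i)) \<partial>(\<Pi>\<^sub>M i\<in>I. J))"
    proof (rule nn_integral_cong)
      fix z assume z: "z \<in> space (\<Pi>\<^sub>M i\<in>I. J)"
      have "indicator (Pi\<^sub>E I A) z = (\<Prod>i\<in>I. indicator (A i) (z i) :: ennreal)"
      proof (cases "z \<in> Pi\<^sub>E I A")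
        case True then show ?thesis by (auto simp: PiE_mem)
      next
        case False
        then obtain i where "i \<in> I" "z i \<notin> A i" using z by (auto simp: space_PiM PiE_iff)
        then show ?thesis using False I by (auto intro!: prod_zero[symmetric] bexI[of _ i])
      qed
      then show "ennreal (\<Prod>i\<in>I. f (z i)) * indicator (Pi\<^sub>E I A) z
          = (\<Prod>i\<in>I. ennreal (f (z i)) * indicator (A i) (z i))"
        using nn by (simp add: prod.distrib prod_ennreal)
    qed
    also have "\<dots> = (\<Prod>i\<in>I. \<integral>\<^sup>+ x. ennreal (f x) * indicator (A i) x \<partial>J)"
      using AJ I by (intro J.product_nn_integral_prod) auto
    also have "\<dots> = (\<Prod>i\<in>I. emeasure (density J f) (A i))"
      using AJ by (intro prod.cong refl emeasure_density[symmetric]) auto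
    finally show "emeasure (density (\<Pi>\<^sub>M i\<in>I. J) (\<lambda>z. ennreal (\<Prod>i\<in>I. f (z i)))) (Pi\<^sub>E I A)
      = (\<Prod>i\<in>I. emeasure (density J f) (A i))" .
  qed
  then show ?thesis by simp
qed

lemma prob_space_density_one_plus:
  assumes J: "prob_space J" and r[measurable]: "r \<in> borel_measurable J"
    and b: "\<And>x. \<bar>r x\<bar> \<le> (1::real)" and mean: "(\<integral>x. r x \<partial>J) = 0"
  shows "prob_space (density J (\<lambda>x. ennreal (1 + r x)))"
proof -
  interpret prob_space J by fact
  have i: "integrable J r" using b by (intro integrable_const_bound[where B=1]) auto
  have nn: "0 \<le> 1 + r x" for x using b[of x] by linarith
  have "(\<integral>\<^sup>+ x. ennreal (1 + r x) \<partial>J) = ennreal (\<integral>x. 1 + r x \<partial>J)"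
    using i nn by (intro nn_integral_eq_integral) auto
  also have "\<dots> = 1" using i mean by (simp add: prob_space)
  finally show ?thesis
    by (intro prob_spaceI) (simp add: emeasure_density cong: nn_integral_cong)
qed

text \<open>
  The one-sided total variation bound behind the testing argument. With \<open>Z\<close> the likelihood ratio of
  the sample, the change of the probability of \<open>A\<close> is the reference expectation of
  \<open>(Z - 1) * 1\<^sub>A\<close>. Its second moment is a product, so \<open>var\<close> says that the chi-square divergence
  of the sample is at most \<open>1 / 4\<close>. A pointwise inequality of the form \<open>x * y \<ge> - (x\<^sup>2 + y\<^sup>2) / 2\<close>
  then plays the role of the Cauchy-Schwarz inequality.
\<close>

lemma measure_PiM_density_ge:
  fixes r :: "'a \<Rightarrow> real"
  assumes J: "prob_space J" and r[measurable]: "r \<in> borel_measurable J"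
    and b: "\<And>x. \<bar>r x\<bar> \<le> 1" and mean: "(\<integral>x. r x \<partial>J) = 0"
    and var: "(1 + (\<integral>x. (r x)\<^sup>2 \<partial>J)) ^ m \<le> 5 / 4"
    and A: "A \<in> sets (\<Pi>\<^sub>M i\<in>{..<m}. J)"
  shows "measure (\<Pi>\<^sub>M i\<in>{..<m}. J) A - 1 / 4
    \<le> measure (\<Pi>\<^sub>M i\<in>{..<m}. density J (\<lambda>x. ennreal (1 + r x))) A"
proof -
  interpret J1: prob_space J by fact
  interpret J: product_prob_space "\<lambda>_. J" "{..<m}"
    using J by (intro product_prob_spaceI)
  define N where "N = (\<Pi>\<^sub>M i\<in>{..<m}. J)"
  interpret N: prob_space N unfolding N_def by (intro prob_space_PiM J)
  define Z where "Z z = (\<Prod>i<m. 1 + r (z i))" for z :: "nat \<Rightarrow> 'a"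
  have nn: "0 \<le> 1 + r x" for x using b[of x] by linarith
  have Zm[measurable]: "Z \<in> borel_measurable N" unfolding Z_def N_def by measurable
  have Znn: "0 \<le> Z z" for z unfolding Z_def using nn by (intro prod_nonneg) auto
  have Zle: "Z z \<le> 2 ^ m" for z
  proof -
    have "Z z \<le> (\<Prod>i<m. 2)" unfolding Z_def
      using nn b by (intro prod_mono) (auto simp: abs_le_iff intro: order_trans[of _ "1 + 1"])
    then show ?thesis by simp
  qed
  have ir: "integrable J r" using b by (intro J1.integrable_const_bound[where B=1]) auto
  have ir2: "integrable J (\<lambda>x. (r x)\<^sup>2)"
    using b by (intro J1.integrable_const_bound[where B=1]) (auto simp: abs_square_le_1)
  have EZ: "(\<integral>z. Z z \<partial>N) = 1"
  proof -
    have "(\<integral>z. Z z \<partial>N) = (\<Prod>i<m. \<integral>x. 1 + r x \<partial>J)"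
      unfolding Z_def N_def using ir by (intro J.product_integral_prod) auto
    then show ?thesis using ir mean by (simp add: J1.prob_space)
  qed
  have EZ2: "(\<integral>z. (Z z)\<^sup>2 \<partial>N) \<le> 5 / 4"
  proof -
    have sq: "(\<lambda>x. (1 + r x)\<^sup>2) = (\<lambda>x. 1 + (2 * r x + (r x)\<^sup>2))"
      by (auto simp: power2_eq_square algebra_simps)
    have "(\<integral>z. (Z z)\<^sup>2 \<partial>N) = (\<integral>z. (\<Prod>i<m. (1 + r (z i))\<^sup>2) \<partial>N)"
      unfolding Z_def by (simp add: prod_power_distrib)
    also have "\<dots> = (\<Prod>i<m. \<integral>x. (1 + r x)\<^sup>2 \<partial>J)"
      unfolding N_def using ir ir2 by (intro J.product_integral_prod) (auto simp: sq)
    also have "(\<integral>x. (1 + r x)\<^sup>2 \<partial>J) = 1 + (\<integral>x. (r x)\<^sup>2 \<partial>J)"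
      unfolding sq using ir ir2 mean by (simp add: J1.prob_space)
    finally show ?thesis using var by simp
  qed
  have iZ: "integrable N Z"
    using Znn Zle by (intro N.integrable_const_bound[where B="2^m"]) auto
  have iZ2: "integrable N (\<lambda>z. (Z z)\<^sup>2)"
    using Znn Zle by (intro N.integrable_const_bound[where B="(2^m)\<^sup>2"]) (auto intro!: power_mono)
  have A'[measurable]: "A \<in> sets N" using A by (simp add: N_def)
  have iA: "integrable N (indicator A :: _ \<Rightarrow> real)"
    by (intro N.integrable_const_bound[where B=1]) auto
  have iZA: "integrable N (\<lambda>z. Z z * indicator A z)"
    using iZ by (rule integrable_real_mult_indicator[OF A'])
  \<comment> \<open>This is \<open>(Z - 1) * (1\<^sub>A - 1 / 2) \<ge> - ((Z - 1)\<^sup>2 + (1\<^sub>A - 1 / 2)\<^sup>2) / 2\<close>, where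
    \<open>(1\<^sub>A - 1 / 2)\<^sup>2\<close> is constantly \<open>1 / 4\<close>. Subtracting \<open>1 / 2\<close> from \<open>1\<^sub>A\<close> is free, as \<open>Z - 1\<close> has
    mean zero.\<close>
  have pw: "indicator A z + (Z z - 1) / 2 - ((Z z)\<^sup>2 - 2 * Z z + 1) / 2 - 1 / 8 \<le> Z z * indicator A z" for z
  proof -
    have "0 \<le> (Z z - 1 + 1 / 2)\<^sup>2" "0 \<le> (Z z - 1 - 1 / 2)\<^sup>2" by auto
    then show ?thesis by (cases "z \<in> A") (auto simp: power2_eq_square field_simps)
  qed
  have "(\<integral>z. indicator A z + (Z z - 1) / 2 - ((Z z)\<^sup>2 - 2 * Z z + 1) / 2 - 1 / 8 \<partial>N)
      \<le> (\<integral>z. Z z * indicator A z \<partial>N)"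
    using iA iZ iZ2 iZA pw by (intro integral_mono) auto
  also have "(\<integral>z. indicator A z + (Z z - 1) / 2 - ((Z z)\<^sup>2 - 2 * Z z + 1) / 2 - 1 / 8 \<partial>N)
      = measure N A - ((\<integral>z. (Z z)\<^sup>2 \<partial>N) - 1) / 2 - 1 / 8"
    using iA iZ iZ2 EZ by (simp add: N.prob_space)
  finally have 1: "measure N A - 1 / 4 \<le> (\<integral>z. Z z * indicator A z \<partial>N)"
    using EZ2 by (simp add: field_simps)
  have "(\<Pi>\<^sub>M i\<in>{..<m}. density J (\<lambda>x. ennreal (1 + r x))) = density N (\<lambda>z. ennreal (Z z))"
    unfolding N_def Z_def using nn
    by (intro PiM_density J prob_space_density_one_plus[OF J r b mean]) auto
  then have "measure (\<Pi>\<^sub>M i\<in>{..<m}. density J (\<lambda>x. ennreal (1 + r x))) A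
      = measure (density N (\<lambda>z. ennreal (Z z))) A" by simp
  also have "\<dots> = (\<integral>z. Z z * indicator A z \<partial>N)"
  proof -
    have "emeasure (density N (\<lambda>z. ennreal (Z z))) A = (\<integral>\<^sup>+ z. ennreal (Z z * indicator A z) \<partial>N)"
      by (simp add: emeasure_density ennreal_mult' Znn ennreal_indicator[symmetric] del: ennreal_indicator
          cong: nn_integral_cong)
    also have "\<dots> = ennreal (\<integral>z. Z z * indicator A z \<partial>N)"
      using iZA Znn by (intro nn_integral_eq_integral) auto
    finally show ?thesis
      using Znn by (simp add: measure_def integral_nonneg_AE)
  qed
  finally show ?thesis using 1 by (simp add: N_def)
qed

section \<open>Laws comparable with the uniform distribution\<close>

definition unif01 :: "real measure" where
  "unif01 = uniform_measure lborel {0..1}"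

lemma sets_unif01[simp, measurable_cong]: "sets unif01 = sets borel"
  by (simp add: unif01_def)

lemma space_unif01[simp]: "space unif01 = UNIV"
  by (simp add: unif01_def)

lemma prob_space_unif01: "prob_space unif01"
  unfolding unif01_def by (intro prob_space_uniform_measure) auto

lemma measure_unif01: "B \<in> sets borel \<Longrightarrow> measure unif01 B = measure lborel ({0..1} \<inter> B)"
  unfolding unif01_def by (subst measure_uniform_measure) (auto simp: measure_def)

lemma measure_unif01_Icc:
  assumes "0 \<le> a" "a \<le> b" "b \<le> 1"
  shows "measure unif01 {a..b} = b - a"
proof -
  have "{0..1} \<inter> {a..b} = {a..b}" using assms by auto
  then show ?thesis using assms by (simp add: measure_unif01)
qed

lemma measure_unif01_Icc_le:
  assumes "a \<le> b"
  shows "measure unif01 {a..b} \<le> b - a"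
proof -
  have "{0..1} \<inter> {a..b} = {max 0 a..min 1 b}" by auto
  then show ?thesis using assms by (auto simp: measure_unif01 max_def min_def)
qed

lemma measure_unif01_atMost:
  assumes "0 \<le> t" "t \<le> 1"
  shows "measure unif01 {..t} = t"
proof -
  have "{0..1} \<inter> {..t} = {0..t}" using assms by auto
  then show ?thesis using assms by (simp add: measure_unif01)
qed

text \<open>
  Having a density between \<open>l\<close> and \<open>u\<close> on the unit interval and none outside, stated on sets.
  Such bounds locate the quantiles well enough for mass regularity.
\<close>

locale unif_comparable = prob_space N for N :: "real measure" +
  fixes l u :: real
  assumes sets_N: "sets N = sets borel"
    and lower: "B \<in> sets borel \<Longrightarrow> l * measure unif01 B \<le> measure N B"
    and upper: "B \<in> sets borel \<Longrightarrow> measure N B \<le> u * measure unif01 B"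
begin

lemma u_ge_1: "1 \<le> u"
proof -
  interpret U: prob_space unif01 by (rule prob_space_unif01)
  have "space N = UNIV" using sets_eq_imp_space_eq[OF sets_N] by simp
  then have "measure N UNIV = 1" "measure unif01 UNIV = 1"
    using prob_space U.prob_space by auto
  then show ?thesis using upper[of UNIV] by auto
qed

text \<open>
  The mass of \<open>(-\<infinity>, y]\<close> is at most \<open>u * y\<close>, so at least \<open>\<tau> / u\<close> is needed to collect mass \<open>\<tau>\<close>; the
  same argument from the right end gives the other bound. The bounds keep the quantiles away from
  the end points, and for \<open>u = 1\<close> they determine the quantile.
\<close>

lemma cond_quantile_bounds:
  assumes P: "P x = N" and t: "0 < \<tau>" "\<tau> < 1"
  shows "\<tau> / u \<le> cond_quantile P \<tau> x" and "cond_quantile P \<tau> x \<le> 1 - (1 - \<tau>) / u"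
proof -
  have u: "1 \<le> u" by (rule u_ge_1)
  define s where "s = 1 - (1 - \<tau>) / u"
  have s: "0 \<le> s" "s \<le> 1" unfolding s_def using u t by (auto simp: field_simps)
  have low: "\<tau> / u \<le> y" if y: "\<tau> \<le> measure N {..y}" for y
  proof -
    have y0: "0 \<le> y"
    proof (rule ccontr)
      assume "\<not> 0 \<le> y"
      then have "{0..1} \<inter> {..y} = {}" by auto
      then have "measure unif01 {..y} = 0" by (simp add: measure_unif01)
      then show False using upper[of "{..y}"] y t by auto
    qed
    show ?thesis
    proof (cases "y \<le> 1")
      case True
      then have "\<tau> \<le> u * y" using upper[of "{..y}"] y y0 by (simp add: measure_unif01_atMost)
      then show ?thesis using u by (simp add: field_simps)
    next
      case False
      then show ?thesis using u t by (simp add: field_simps) (smt (verit) mult_less_cancel_left2)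
    qed
  qed
  have "\<tau> \<le> measure N {..s}"
  proof -
    have c: "{s<..} = space N - {..s}" using sets_eq_imp_space_eq[OF sets_N] by auto
    have "measure unif01 {s<..} = 1 - s"
    proof -
      interpret U: prob_space unif01 by (rule prob_space_unif01)
      have "{s<..} = space unif01 - {..s}" by auto
      then show ?thesis using U.prob_compl[of "{..s}"] s by (simp add: measure_unif01_atMost)
    qed
    then have "measure N {s<..} \<le> u * (1 - s)" using upper[of "{s<..}"] by simp
    also have "\<dots> = 1 - \<tau>" unfolding s_def using u by simp
    finally show ?thesis using prob_compl[of "{..s}"] c by (simp add: sets_N)
  qed
  then have mem: "s \<in> {t. \<tau> \<le> measure (P x) {..t}}" by (simp add: P)
  have bdd: "bdd_below {t. \<tau> \<le> measure (P x) {..t}}"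
    using low by (intro bdd_belowI[of _ "\<tau> / u"]) (auto simp: P)
  show "\<tau> / u \<le> cond_quantile P \<tau> x"
    unfolding cond_quantile_def using mem low by (intro cInf_greatest) (auto simp: P)
  show "cond_quantile P \<tau> x \<le> 1 - (1 - \<tau>) / u"
    unfolding cond_quantile_def s_def[symmetric] using mem bdd by (intro cInf_lower)
qed

end

text \<open>
  The radius \<open>\<alpha> / (2 * u)\<close> is at most the distance from either quantile to the boundary of \<open>[0, 1]\<close>,
  so intervals of that length next to a quantile lie where the density is at least \<open>l\<close>.
\<close>

lemma mass_regular_on_unif_comparable:
  assumes a: "0 < \<alpha>" "\<alpha> < 1" and P: "\<And>x. x \<in> X0 \<Longrightarrow> unif_comparable (P x) l u"
    and lu: "0 < l" "l \<le> u"
  shows "mass_regular_on \<alpha> P X0"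
  unfolding mass_regular_on_def
proof (intro exI conjI ballI allI impI)
  show "0 < l" "l \<le> u" by fact+
  show "0 < \<alpha> / (2 * u)" using a lu by simp
next
  fix x and a b :: real assume "x \<in> X0" and ab: "a \<le> b"
  interpret unif_comparable "P x" l u by (rule P) fact
  have "measure (P x) {a..b} \<le> u * measure unif01 {a..b}" by (rule upper) simp
  also have "\<dots> \<le> u * (b - a)" using measure_unif01_Icc_le[OF ab] lu by (intro mult_left_mono) auto
  finally show "measure (P x) {a..b} \<le> u * (b - a)" .
next
  fix x \<tau> h assume x: "x \<in> X0" and \<tau>: "\<tau> \<in> {\<alpha> / 2, 1 - \<alpha> / 2}" and h: "0 \<le> h \<and> h \<le> \<alpha> / (2 * u)"
  interpret unif_comparable "P x" l u by (rule P) fact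
  let ?f = "cond_quantile P \<tau> x"
  have t: "\<alpha> / 2 \<le> \<tau>" "\<alpha> / 2 \<le> 1 - \<tau>" "0 < \<tau>" "\<tau> < 1" using \<tau> a by auto
  have "\<alpha> / (2 * u) \<le> \<tau> / u" "\<alpha> / (2 * u) \<le> (1 - \<tau>) / u"
    using t u_ge_1 divide_right_mono[of "\<alpha>/2" \<tau> u] divide_right_mono[of "\<alpha>/2" "1 - \<tau>" u] by auto
  then have f: "h \<le> ?f" "?f + h \<le> 1" using cond_quantile_bounds[of P x \<tau>] t h by auto
  show "l * h \<le> measure (P x) {?f - h..?f}"
    using lower[of "{?f - h..?f}"] f h by (simp add: measure_unif01_Icc)
  show "l * h \<le> measure (P x) {?f..?f + h}"
    using lower[of "{?f..?f + h}"] f h by (simp add: measure_unif01_Icc)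
qed

section \<open>The perturbed kernels\<close>

text \<open>
  The direction of perturbation: up to scale the only function that is constant on
  \<open>[\<alpha> / 2, 1 - \<alpha> / 2]\<close> and on its complement in \<open>[0, 1]\<close> and has mean zero under the uniform law.
  The scale is such that the tilt by \<open>d\<close> moves mass exactly \<open>d\<close> into the central interval.
\<close>

definition central_contrast :: "real \<Rightarrow> real \<Rightarrow> real" where
  "central_contrast \<alpha> y = (if y \<in> {\<alpha> / 2..1 - \<alpha> / 2} then 1 / (1 - \<alpha>) else - 1 / \<alpha>)"

definition tilted_unif :: "real \<Rightarrow> real \<Rightarrow> real measure" where
  "tilted_unif \<alpha> d = density unif01 (\<lambda>y. ennreal (1 + d * central_contrast \<alpha> y))"

text \<open>
  Perturbing at \<open>x1\<close> only makes the observations with covariate \<open>x2\<close> uninformative.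
\<close>

definition spike_kernel :: "real \<Rightarrow> 'x \<Rightarrow> real \<Rightarrow> 'x \<Rightarrow> real measure" where
  "spike_kernel \<alpha> x1 d x = tilted_unif \<alpha> (if x = x1 then d else 0)"

lemma central_contrast_measurable[measurable]: "central_contrast \<alpha> \<in> borel_measurable borel"
  unfolding central_contrast_def by measurable

lemma central_contrast_moments:
  assumes a: "0 < \<alpha>" "\<alpha> < 1"
  shows "(\<integral>y. central_contrast \<alpha> y \<partial>unif01) = 0"
    and "(\<integral>y. (central_contrast \<alpha> y)\<^sup>2 \<partial>unif01) = 1 / (\<alpha> * (1 - \<alpha>))"
proof -
  interpret prob_space unif01 by (rule prob_space_unif01)
  let ?C = "{\<alpha> / 2..1 - \<alpha> / 2}"
  have C: "measure unif01 ?C = 1 - \<alpha>" using a by (subst measure_unif01_Icc) auto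
  have i: "integrable unif01 (indicator ?C :: _ \<Rightarrow> real)"
    by (intro integrable_const_bound[where B=1]) auto
  have one: "measure unif01 UNIV = 1" using prob_space by simp
  have e: "central_contrast \<alpha> = (\<lambda>y. - 1 / \<alpha> + (1 / (1 - \<alpha>) + 1 / \<alpha>) * indicator ?C y)"
    by (auto simp: central_contrast_def fun_eq_iff indicator_def)
  have e2: "(\<lambda>y. (central_contrast \<alpha> y)\<^sup>2)
      = (\<lambda>y. 1 / \<alpha>\<^sup>2 + (1 / (1 - \<alpha>)\<^sup>2 - 1 / \<alpha>\<^sup>2) * indicator ?C y)"
    by (auto simp: central_contrast_def fun_eq_iff indicator_def power_divide)
  have "(\<integral>y. central_contrast \<alpha> y \<partial>unif01) = - 1 / \<alpha> + (1 / (1 - \<alpha>) + 1 / \<alpha>) * (1 - \<alpha>)"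
    unfolding e using i C by (simp add: one)
  then show "(\<integral>y. central_contrast \<alpha> y \<partial>unif01) = 0" using a by (simp add: field_simps)
  have "(\<integral>y. (central_contrast \<alpha> y)\<^sup>2 \<partial>unif01) = 1 / \<alpha>\<^sup>2 + (1 / (1 - \<alpha>)\<^sup>2 - 1 / \<alpha>\<^sup>2) * (1 - \<alpha>)"
    unfolding e2 using i C by (simp add: one)
  also have "\<dots> = 1 / (\<alpha> * (1 - \<alpha>))" using a by (simp add: divide_simps) (simp add: power2_eq_square algebra_simps)
  finally show "(\<integral>y. (central_contrast \<alpha> y)\<^sup>2 \<partial>unif01) = 1 / (\<alpha> * (1 - \<alpha>))" .
qed

text \<open>The admissible size of the perturbation, which keeps tilted densities in \<open>[1 / 2, 3 / 2]\<close>.\<close>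

lemma abs_central_contrast_le:
  assumes a: "0 < \<alpha>" "\<alpha> < 1" and d: "\<bar>d\<bar> \<le> min \<alpha> (1 - \<alpha>) / 2"
  shows "\<bar>d * central_contrast \<alpha> y\<bar> \<le> 1 / 2"
proof -
  have "\<bar>d\<bar> / \<alpha> \<le> 1 / 2" "\<bar>d\<bar> / (1 - \<alpha>) \<le> 1 / 2" using a d by (auto simp: field_simps)
  then show ?thesis using a by (auto simp: central_contrast_def abs_mult)
qed

lemma sets_tilted_unif[simp]: "sets (tilted_unif \<alpha> d) = sets borel"
  by (simp add: tilted_unif_def)

lemma tilted_unif_0[simp]: "tilted_unif \<alpha> 0 = unif01"
  by (simp add: tilted_unif_def density_1)

lemma spike_kernel_0[simp]: "spike_kernel \<alpha> x1 0 x = unif01"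
  by (simp add: spike_kernel_def)

lemma prob_space_tilted_unif:
  assumes "0 < \<alpha>" "\<alpha> < 1" "\<bar>d\<bar> \<le> min \<alpha> (1 - \<alpha>) / 2"
  shows "prob_space (tilted_unif \<alpha> d)"
  unfolding tilted_unif_def
proof (rule prob_space_density_one_plus)
  show "prob_space unif01" by (rule prob_space_unif01)
  show "\<bar>d * central_contrast \<alpha> y\<bar> \<le> 1" for y
    using abs_central_contrast_le[OF assms, of y] by linarith
qed (use assms in \<open>simp_all add: central_contrast_moments\<close>)

lemma measure_tilted_unif:
  assumes a: "0 < \<alpha>" "\<alpha> < 1" and d: "\<bar>d\<bar> \<le> min \<alpha> (1 - \<alpha>) / 2" and B: "B \<in> sets borel"
  shows "integrable unif01 (\<lambda>y. (1 + d * central_contrast \<alpha> y) * indicator B y)" (is ?I)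
    and "measure (tilted_unif \<alpha> d) B = (\<integral>y. (1 + d * central_contrast \<alpha> y) * indicator B y \<partial>unif01)"
proof -
  interpret prob_space unif01 by (rule prob_space_unif01)
  have b: "\<bar>d * central_contrast \<alpha> y\<bar> \<le> 1 / 2" for y by (rule abs_central_contrast_le[OF a d])
  have nn: "0 \<le> 1 + d * central_contrast \<alpha> y" "1 + d * central_contrast \<alpha> y \<le> 2" for y
    using b[of y] by linarith+
  show I: ?I
    using B nn by (intro integrable_const_bound[where B=2]) (auto simp: indicator_def)
  have "emeasure (tilted_unif \<alpha> d) B
      = (\<integral>\<^sup>+ y. ennreal ((1 + d * central_contrast \<alpha> y) * indicator B y) \<partial>unif01)"
    unfolding tilted_unif_def using B nn
    by (subst emeasure_density) (auto intro!: nn_integral_cong simp: indicator_def)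
  also have "\<dots> = ennreal (\<integral>y. (1 + d * central_contrast \<alpha> y) * indicator B y \<partial>unif01)"
    using I nn by (intro nn_integral_eq_integral) auto
  finally show "measure (tilted_unif \<alpha> d) B = (\<integral>y. (1 + d * central_contrast \<alpha> y) * indicator B y \<partial>unif01)"
    using nn by (simp add: measure_def integral_nonneg_AE)
qed

lemma unif_comparable_tilted_unif:
  assumes a: "0 < \<alpha>" "\<alpha> < 1" and d: "\<bar>d\<bar> \<le> min \<alpha> (1 - \<alpha>) / 2"
  shows "unif_comparable (tilted_unif \<alpha> d) (1 / 2) (3 / 2)"
proof (intro unif_comparable.intro unif_comparable_axioms.intro prob_space_tilted_unif[OF a d])
  interpret U: prob_space unif01 by (rule prob_space_unif01)
  fix B :: "real set" assume B: "B \<in> sets borel"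
  have b: "1 / 2 \<le> 1 + d * central_contrast \<alpha> y" "1 + d * central_contrast \<alpha> y \<le> 3 / 2" for y
    using abs_central_contrast_le[OF a d, of y] by linarith+
  have i: "integrable unif01 (indicator B :: _ \<Rightarrow> real)"
    using B by (intro U.integrable_const_bound[where B=1]) auto
  have ib: "1 / 2 * indicator B y \<le> (1 + d * central_contrast \<alpha> y) * (indicator B y :: real)"
    "(1 + d * central_contrast \<alpha> y) * indicator B y \<le> 3 / 2 * (indicator B y :: real)" for y
    by (intro mult_right_mono b; simp)+
  have "(\<integral>y. 1 / 2 * indicator B y \<partial>unif01) \<le> (\<integral>y. (1 + d * central_contrast \<alpha> y) * indicator B y \<partial>unif01)"
    using i B by (intro integral_mono measure_tilted_unif(1)[OF a d] ib) auto
  then show "1 / 2 * measure unif01 B \<le> measure (tilted_unif \<alpha> d) B"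
    using B by (simp add: measure_tilted_unif(2)[OF a d])
  have "(\<integral>y. (1 + d * central_contrast \<alpha> y) * indicator B y \<partial>unif01) \<le> (\<integral>y. 3 / 2 * indicator B y \<partial>unif01)"
    using i B by (intro integral_mono measure_tilted_unif(1)[OF a d] ib) auto
  then show "measure (tilted_unif \<alpha> d) B \<le> 3 / 2 * measure unif01 B"
    using B by (simp add: measure_tilted_unif(2)[OF a d])
qed auto

lemma measure_tilted_unif_central:
  assumes a: "0 < \<alpha>" "\<alpha> < 1" and d: "\<bar>d\<bar> \<le> min \<alpha> (1 - \<alpha>) / 2"
  shows "measure (tilted_unif \<alpha> d) {\<alpha> / 2..1 - \<alpha> / 2} = 1 - \<alpha> + d"
proof -
  have "(\<lambda>y. (1 + d * central_contrast \<alpha> y) * indicator {\<alpha> / 2..1 - \<alpha> / 2} y)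
      = (\<lambda>y. (1 + d / (1 - \<alpha>)) * indicator {\<alpha> / 2..1 - \<alpha> / 2} y)"
    by (auto simp: central_contrast_def indicator_def fun_eq_iff)
  then have "measure (tilted_unif \<alpha> d) {\<alpha> / 2..1 - \<alpha> / 2}
      = (1 + d / (1 - \<alpha>)) * measure unif01 {\<alpha> / 2..1 - \<alpha> / 2}"
    by (simp add: measure_tilted_unif(2)[OF a d])
  also have "\<dots> = 1 - \<alpha> + d"
    using a by (subst measure_unif01_Icc) (auto simp: field_simps)
  finally show ?thesis .
qed

lemma cond_quantile_unif01:
  assumes "P x = unif01" "0 < \<tau>" "\<tau> < 1"
  shows "cond_quantile P \<tau> x = \<tau>"
proof -
  interpret unif_comparable unif01 1 1
    by (intro unif_comparable.intro unif_comparable_axioms.intro prob_space_unif01) auto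
  show ?thesis using cond_quantile_bounds[of P x \<tau>] assms by auto
qed

lemma cqr_score_unif01:
  assumes "0 < \<alpha>" "\<alpha> < 1" "P x = unif01"
  shows "cqr_score \<alpha> P x y = max (\<alpha> / 2 - y) (y - (1 - \<alpha> / 2))"
  using assms by (simp add: cqr_score_def cond_quantile_unif01)

text \<open>
  All values of the kernel are comparable with the uniform law with the same constants, so
  mass regularity holds on the whole space.
\<close>

lemma spike_kernel_admissible:
  assumes a: "0 < \<alpha>" "\<alpha> < 1" and d: "\<bar>d\<bar> \<le> min \<alpha> (1 - \<alpha>) / 2"
    and PX: "prob_space PX" and x1: "{x1} \<in> sets PX"
  shows "spike_kernel \<alpha> x1 d \<in> admissible_kernels \<alpha> PX"
proof -
  have 0: "\<bar>0::real\<bar> \<le> min \<alpha> (1 - \<alpha>) / 2" using a by auto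
  have "{x \<in> space PX. x = x1} = {x1}" using sets.sets_into_space[OF x1] by auto
  then have s: "{x \<in> space PX. x = x1} \<in> sets PX" using x1 by simp
  have "spike_kernel \<alpha> x1 d \<in> prob_kernel PX"
    unfolding prob_kernel_def spike_kernel_def if_distrib[of "tilted_unif \<alpha>"]
    using a d 0 s
    by (intro measurable_If measurable_const) (auto simp: space_prob_algebra prob_space_tilted_unif
        intro!: prob_space_unif01)
  moreover have "mass_regular_on \<alpha> (spike_kernel \<alpha> x1 d) (space PX)"
    using a d 0 by (intro mass_regular_on_unif_comparable[where l="1/2" and u="3/2"])
      (auto simp: spike_kernel_def simp del: tilted_unif_0 intro!: unif_comparable_tilted_unif)
  then have "mass_regular_ae \<alpha> PX (spike_kernel \<alpha> x1 d)"
    unfolding mass_regular_ae_def using prob_space.emeasure_space_1[OF PX]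
    by (intro bexI[of _ "space PX"]) auto
  ultimately show ?thesis by (simp add: admissible_kernels_def)
qed

section \<open>Two-point covariate laws\<close>

definition two_point :: "'x measure \<Rightarrow> real \<Rightarrow> 'x \<Rightarrow> 'x \<Rightarrow> 'x measure" where
  "two_point M p x1 x2 = distr (measure_pmf (bernoulli_pmf p)) M (\<lambda>b. if b then x1 else x2)"

lemma sets_two_point[simp, measurable_cong]: "sets (two_point M p x1 x2) = sets M"
  and space_two_point[simp]: "space (two_point M p x1 x2) = space M"
  by (simp_all add: two_point_def)

lemma prob_space_two_point:
  assumes "x1 \<in> space M" "x2 \<in> space M"
  shows "prob_space (two_point M p x1 x2)"
  unfolding two_point_def using assms
  by (intro prob_space.prob_space_distr prob_space_measure_pmf) auto

lemma nn_integral_two_point: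
  assumes "x1 \<in> space M" "x2 \<in> space M" "0 \<le> p" "p \<le> 1" "f \<in> borel_measurable M"
  shows "(\<integral>\<^sup>+ x. f x \<partial>two_point M p x1 x2) = f x1 * ennreal p + f x2 * ennreal (1 - p)"
  unfolding two_point_def using assms by (subst nn_integral_distr) auto

lemma return_eq_density_two_point:
  assumes x: "x1 \<in> space M" "x2 \<in> space M" "x1 \<noteq> x2" "{x1} \<in> sets M" and p: "0 < p" "p \<le> 1"
  shows "return M x1 = density (two_point M p x1 x2) (\<lambda>x. ennreal (1 / p) * indicator {x1} x)"
proof (rule measure_eqI)
  fix A assume "A \<in> sets (return M x1)"
  then have A: "A \<in> sets M" by simp
  have "emeasure (density (two_point M p x1 x2) (\<lambda>x. ennreal (1 / p) * indicator {x1} x)) A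
      = (\<integral>\<^sup>+ x. ennreal (1 / p) * indicator {x1} x * indicator A x \<partial>two_point M p x1 x2)"
    using A x by (intro emeasure_density) auto
  also have "\<dots> = ennreal (1 / p) * indicator A x1 * ennreal p"
    using A x p by (subst nn_integral_two_point) auto
  also have "\<dots> = indicator A x1"
    using p by (simp add: indicator_def ennreal_mult[symmetric])
  finally show "emeasure (return M x1) A
      = emeasure (density (two_point M p x1 x2) (\<lambda>x. ennreal (1 / p) * indicator {x1} x)) A"
    using A by simp
qed simp

lemma RN_deriv_two_point_return:
  assumes x: "x1 \<in> space M" "x2 \<in> space M" "x1 \<noteq> x2" "{x1} \<in> sets M" and p: "0 < p" "p \<le> 1"
  shows "AE x in two_point M p x1 x2.
    RN_deriv (two_point M p x1 x2) (return M x1) x = ennreal (1 / p) * indicator {x1} x"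
proof -
  interpret prob_space "two_point M p x1 x2" using x by (intro prob_space_two_point)
  have "AE x in two_point M p x1 x2. ennreal (1 / p) * indicator {x1} x
      = RN_deriv (two_point M p x1 x2) (return M x1) x"
    using x by (intro RN_deriv_unique return_eq_density_two_point[OF x p, symmetric]) auto
  then show ?thesis by eventually_elim simp
qed

text \<open>
  The likelihood ratio is \<open>1 + \<kappa>\<close> at \<open>x1\<close> and \<open>0\<close> at \<open>x2\<close>, so the divergence is
  \<open>\<kappa>\<^sup>2 / (1 + \<kappa>) + \<kappa> / (1 + \<kappa>)\<close>.
\<close>

lemma chi_square_two_point_return:
  assumes x: "x1 \<in> space M" "x2 \<in> space M" "x1 \<noteq> x2" "{x1} \<in> sets M" and k: "0 < \<kappa>"
  shows "chi_square (return M x1) (two_point M (1 / (1 + \<kappa>)) x1 x2) = ennreal \<kappa>"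
proof -
  let ?p = "1 / (1 + \<kappa>)"
  have p: "0 < ?p" "?p \<le> 1" using k by auto
  have "chi_square (return M x1) (two_point M ?p x1 x2)
    = (\<integral>\<^sup>+ x. ennreal (((1 + \<kappa>) * indicator {x1} x - 1)\<^sup>2) \<partial>two_point M ?p x1 x2)"
    unfolding chi_square_def
  proof (rule nn_integral_cong_AE)
    show "AE x in two_point M ?p x1 x2.
      ennreal ((enn2real (RN_deriv (two_point M ?p x1 x2) (return M x1) x) - 1)\<^sup>2)
        = ennreal (((1 + \<kappa>) * indicator {x1} x - 1)\<^sup>2)"
      using RN_deriv_two_point_return[OF x p]
      by eventually_elim (use k in \<open>auto simp: indicator_def simp del: ennreal_plus\<close>)
  qed
  also have "\<dots> = ennreal (\<kappa>\<^sup>2) * ennreal ?p + ennreal 1 * ennreal (1 - ?p)"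
    using x p by (subst nn_integral_two_point) auto
  also have "\<dots> = ennreal (\<kappa>\<^sup>2 * ?p + (1 - ?p))"
    using p by (simp add: ennreal_mult[symmetric] ennreal_plus[symmetric] del: ennreal_plus)
  also have "\<kappa>\<^sup>2 * ?p + (1 - ?p) = \<kappa>" using k by (simp add: divide_simps power2_eq_square; simp add: algebra_simps)
  finally show ?thesis .
qed

text \<open>
  A Dirac target turns every norm into an evaluation, which is why one bound serves all \<open>p\<close>.
\<close>

lemma Lp_norm_return:
  assumes x: "x \<in> space M" and g[measurable]: "g \<in> borel_measurable M" and p: "1 \<le> p"
  shows "Lp_norm p (return M x) g \<ge> ennreal \<bar>g x\<bar>"
proof (cases "p = \<infinity>")
  case True
  have "AE y in return M x. ennreal \<bar>g y\<bar> \<le> esssup (return M x) (\<lambda>x. ennreal \<bar>g x\<bar>)"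
    by (rule esssup_AE)
  then show ?thesis using True x by (subst (asm) AE_return) (auto simp: Lp_norm_def)
next
  case False
  then obtain r where r: "p = ennreal r" "0 \<le> r" by (cases p) auto
  then have "1 \<le> r" using p by (simp add: ennreal_1[symmetric] del: ennreal_1)
  then have "Lp_norm p (return M x) g = ennreal ((\<bar>g x\<bar> powr r) powr (1 / r))"
    using False x r by (simp add: Lp_norm_def Let_def nn_integral_return)
  also have "\<dots> = ennreal \<bar>g x\<bar>" using \<open>1 \<le> r\<close> by (simp add: powr_powr)
  finally show ?thesis by simp
qed

section \<open>The sampling laws\<close>

text \<open>
  All joint laws are given densities with respect to one product measure, the joint law of the
  reference kernel, so that sample laws can be compared through products of likelihood ratios.
\<close>

lemma joint_law_spike_kernel:
  assumes a: "0 < \<alpha>" "\<alpha> < 1" and d: "\<bar>d\<bar> \<le> min \<alpha> (1 - \<alpha>) / 2"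
    and PX: "prob_space PX" and x1: "{x1} \<in> sets PX"
  shows "joint_law PX (spike_kernel \<alpha> x1 d) = density (PX \<Otimes>\<^sub>M unif01)
    (\<lambda>z. ennreal (1 + d * (indicator {x1} (fst z) * central_contrast \<alpha> (snd z))))"
    (is "_ = density _ ?h")
proof (rule measure_eqI)
  interpret PX: prob_space PX by fact
  interpret U: prob_space unif01 by (rule prob_space_unif01)
  note [measurable] = x1
  let ?K = "spike_kernel \<alpha> x1 d"
  have ne: "space PX \<noteq> {}" by (rule PX.not_empty)
  have K[measurable]: "?K \<in> PX \<rightarrow>\<^sub>M prob_algebra borel"
    using spike_kernel_admissible[OF a d PX x1] by (simp add: admissible_kernels_def prob_kernel_def)
  have K': "?K \<in> PX \<rightarrow>\<^sub>M subprob_algebra borel" by (rule measurable_prob_algebraD[OF K])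
  have inner: "(\<lambda>x. ?K x \<bind> (\<lambda>y. return (PX \<Otimes>\<^sub>M borel) (x, y))) \<in> PX \<rightarrow>\<^sub>M subprob_algebra (PX \<Otimes>\<^sub>M borel)"
    by (intro measurable_bind[OF K']) simp
  have setsJ: "sets (joint_law PX ?K) = sets (PX \<Otimes>\<^sub>M borel)"
    unfolding joint_law_def by (rule sets_bind[OF sets_kernel[OF inner] ne])
  have setsU: "sets (PX \<Otimes>\<^sub>M unif01) = sets (PX \<Otimes>\<^sub>M borel)"
    by (intro sets_pair_measure_cong) auto
  show "sets (joint_law PX ?K) = sets (density (PX \<Otimes>\<^sub>M unif01) ?h)"
    using setsJ setsU by simp
  fix A assume "A \<in> sets (joint_law PX ?K)"
  then have A[measurable]: "A \<in> sets (PX \<Otimes>\<^sub>M borel)" using setsJ by simp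
  have A'[measurable]: "A \<in> sets (PX \<Otimes>\<^sub>M unif01)" using A setsU by simp
  have hm[measurable]: "?h \<in> borel_measurable (PX \<Otimes>\<^sub>M unif01)" by measurable
  have "emeasure (joint_law PX ?K) A
      = (\<integral>\<^sup>+ x. emeasure (?K x \<bind> (\<lambda>y. return (PX \<Otimes>\<^sub>M borel) (x, y))) A \<partial>PX)"
    unfolding joint_law_def by (rule emeasure_bind[OF ne inner A])
  also have "\<dots> = (\<integral>\<^sup>+ x. \<integral>\<^sup>+ y. ?h (x, y) * indicator A (x, y) \<partial>unif01 \<partial>PX)"
  proof (rule nn_integral_cong)
    fix x assume x: "x \<in> space PX"
    have sK: "sets (?K x) = sets borel" "space (?K x) = UNIV"
      by (auto simp: spike_kernel_def tilted_unif_def)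
    have m: "(\<lambda>y. (x, y)) \<in> ?K x \<rightarrow>\<^sub>M PX \<Otimes>\<^sub>M borel"
      using x by (simp add: measurable_cong_sets[OF sK(1) refl])
    have Ax: "Pair x -` A \<in> sets borel" using A by (rule sets_Pair1)
    have "emeasure (?K x \<bind> (\<lambda>y. return (PX \<Otimes>\<^sub>M borel) (x, y))) A = emeasure (?K x) (Pair x -` A)"
      using m sK by (subst bind_return_distr') (auto simp: emeasure_distr)
    also have "\<dots> = (\<integral>\<^sup>+ y. ennreal (1 + (if x = x1 then d else 0) * central_contrast \<alpha> y)
        * indicator (Pair x -` A) y \<partial>unif01)"
      unfolding spike_kernel_def tilted_unif_def using Ax by (intro emeasure_density) auto
    also have "\<dots> = (\<integral>\<^sup>+ y. ?h (x, y) * indicator A (x, y) \<partial>unif01)"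
      by (intro nn_integral_cong) (auto simp: indicator_def)
    finally show "emeasure (?K x \<bind> (\<lambda>y. return (PX \<Otimes>\<^sub>M borel) (x, y))) A
      = (\<integral>\<^sup>+ y. ?h (x, y) * indicator A (x, y) \<partial>unif01)" .
  qed
  also have "\<dots> = (\<integral>\<^sup>+ z. ?h z * indicator A z \<partial>(PX \<Otimes>\<^sub>M unif01))"
    by (intro U.nn_integral_fst) simp
  also have "\<dots> = emeasure (density (PX \<Otimes>\<^sub>M unif01) ?h) A"
    by (intro emeasure_density[symmetric]) auto
  finally show "emeasure (joint_law PX ?K) A = emeasure (density (PX \<Otimes>\<^sub>M unif01) ?h) A" .
qed

text \<open>
  The perturbation factorizes into a function of the covariate and one of the response, hence the
  second moment of \<open>central_contrast\<close> is multiplied by the mass of \<open>x1\<close>.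
\<close>

lemma spike_moments:
  assumes a: "0 < \<alpha>" "\<alpha> < 1" and PX: "prob_space PX" and x1: "{x1} \<in> sets PX"
  shows "(\<integral>z. d * (indicator {x1} (fst z) * central_contrast \<alpha> (snd z)) \<partial>(PX \<Otimes>\<^sub>M unif01)) = 0"
    and "(\<integral>z. (d * (indicator {x1} (fst z) * central_contrast \<alpha> (snd z)))\<^sup>2 \<partial>(PX \<Otimes>\<^sub>M unif01))
      = d\<^sup>2 * measure PX {x1} / (\<alpha> * (1 - \<alpha>))"
proof -
  interpret PX: prob_space PX by fact
  interpret U: prob_space unif01 by (rule prob_space_unif01)
  interpret PU: pair_prob_space PX unif01 ..
  note [measurable] = x1
  have c: "\<bar>central_contrast \<alpha> y\<bar> \<le> 1 / \<alpha> + 1 / (1 - \<alpha>)" for y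
    using a by (auto simp: central_contrast_def)
  have prod: "(\<integral>z. indicator {x1} (fst z) * g (snd z) \<partial>(PX \<Otimes>\<^sub>M unif01))
      = measure PX {x1} * (\<integral>y. g y \<partial>unif01)"
    if [measurable]: "g \<in> borel_measurable borel" and B: "\<And>y. \<bar>g y\<bar> \<le> B" for g :: "real \<Rightarrow> real" and B
  proof -
    have "integrable (PX \<Otimes>\<^sub>M unif01) (\<lambda>(x, y). indicator {x1} x * g y)"
      using B order_trans[OF abs_ge_zero B]
      by (intro PU.P.integrable_const_bound[where B=B]) (auto simp: indicator_def)
    from PU.integral_fst'[OF this] show ?thesis
      by (simp add: case_prod_unfold)
  qed
  show "(\<integral>z. d * (indicator {x1} (fst z) * central_contrast \<alpha> (snd z)) \<partial>(PX \<Otimes>\<^sub>M unif01)) = 0"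
    using prod[of "central_contrast \<alpha>", OF _ c] central_contrast_moments(1)[OF a] by simp
  have sq: "(d * (indicator {x1} (fst z) * central_contrast \<alpha> (snd z)))\<^sup>2
      = d\<^sup>2 * (indicator {x1} (fst z) * (central_contrast \<alpha> (snd z))\<^sup>2)" for z
    by (auto simp: power_mult_distrib indicator_def)
  have "\<bar>(central_contrast \<alpha> y)\<^sup>2\<bar> \<le> (1 / \<alpha> + 1 / (1 - \<alpha>))\<^sup>2" for y
    using power_mono[OF c[of y], of 2] by simp
  from prod[of "\<lambda>y. (central_contrast \<alpha> y)\<^sup>2", OF _ this] show
    "(\<integral>z. (d * (indicator {x1} (fst z) * central_contrast \<alpha> (snd z)))\<^sup>2 \<partial>(PX \<Otimes>\<^sub>M unif01))
      = d\<^sup>2 * measure PX {x1} / (\<alpha> * (1 - \<alpha>))"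
    unfolding sq using central_contrast_moments(2)[OF a] by simp
qed

lemma sample_law_spike_kernel_ge:
  assumes a: "0 < \<alpha>" "\<alpha> < 1" and d: "\<bar>d\<bar> \<le> min \<alpha> (1 - \<alpha>) / 2"
    and PX: "prob_space PX" and x1: "{x1} \<in> sets PX"
    and m: "(1 + d\<^sup>2 * measure PX {x1} / (\<alpha> * (1 - \<alpha>))) ^ m \<le> 5 / 4"
    and A: "A \<in> sets (\<Pi>\<^sub>M i\<in>{..<m}. PX \<Otimes>\<^sub>M (borel :: real measure))"
  shows "measure (\<Pi>\<^sub>M i\<in>{..<m}. PX \<Otimes>\<^sub>M unif01) A - 1 / 4
    \<le> measure (sample_law m PX (spike_kernel \<alpha> x1 d)) A"
  unfolding sample_law_def joint_law_spike_kernel[OF a d PX x1]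
proof (rule measure_PiM_density_ge)
  interpret PX: prob_space PX by fact
  interpret U: prob_space unif01 by (rule prob_space_unif01)
  interpret PU: pair_prob_space PX unif01 ..
  note [measurable] = x1
  show "prob_space (PX \<Otimes>\<^sub>M unif01)" by (rule PU.P.prob_space_axioms)
  show "(\<lambda>z. d * (indicator {x1} (fst z) * central_contrast \<alpha> (snd z))) \<in> borel_measurable (PX \<Otimes>\<^sub>M unif01)"
    by measurable
  show "\<bar>d * (indicator {x1} (fst z) * central_contrast \<alpha> (snd z))\<bar> \<le> 1" for z
    using abs_central_contrast_le[OF a d, of "snd z"] by (auto simp: indicator_def)
  have "sets (PX \<Otimes>\<^sub>M unif01) = sets (PX \<Otimes>\<^sub>M borel)"
    by (intro sets_pair_measure_cong) auto
  then show "A \<in> sets (\<Pi>\<^sub>M i\<in>{..<m}. PX \<Otimes>\<^sub>M unif01)"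
    using A by (simp cong: sets_PiM_cong)
qed (use m in \<open>simp_all only: spike_moments[OF a PX x1]\<close>)

lemma sample_law_spike_kernel:
  assumes a: "0 < \<alpha>" "\<alpha> < 1" and d: "\<bar>d\<bar> \<le> min \<alpha> (1 - \<alpha>) / 2"
    and PX: "prob_space PX" and x1: "{x1} \<in> sets PX"
  shows "sets (sample_law m PX (spike_kernel \<alpha> x1 d)) = sets (\<Pi>\<^sub>M i\<in>{..<m}. PX \<Otimes>\<^sub>M borel)"
    and "prob_space (sample_law m PX (spike_kernel \<alpha> x1 d))"
proof -
  interpret PX: prob_space PX by fact
  interpret U: prob_space unif01 by (rule prob_space_unif01)
  interpret PU: pair_prob_space PX unif01 ..
  note [measurable] = x1
  have "sets (PX \<Otimes>\<^sub>M unif01) = sets (PX \<Otimes>\<^sub>M borel)"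
    by (intro sets_pair_measure_cong) auto
  then show "sets (sample_law m PX (spike_kernel \<alpha> x1 d)) = sets (\<Pi>\<^sub>M i\<in>{..<m}. PX \<Otimes>\<^sub>M borel)"
    unfolding sample_law_def joint_law_spike_kernel[OF a d PX x1] by (simp cong: sets_PiM_cong)
  have b: "\<bar>d * (indicator {x1} (fst z) * central_contrast \<alpha> (snd z))\<bar> \<le> 1" for z
    using abs_central_contrast_le[OF a d, of "snd z"] by (auto simp: indicator_def)
  show "prob_space (sample_law m PX (spike_kernel \<alpha> x1 d))"
    unfolding sample_law_def joint_law_spike_kernel[OF a d PX x1]
    by (intro prob_space_PiM prob_space_density_one_plus PU.P.prob_space_axioms b
        spike_moments[OF a PX x1]) measurable
qed

section \<open>The lower bound\<close>

text \<open>
  The dichotomy that turns a threshold into a test: the acceptance set contains the central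
  interval \<open>{y. S x1 y \<le> 0}\<close> or is contained in it, depending on the sign of \<open>q\<close>. For
  \<open>d > 0\<close> the first bound signals overcoverage, for \<open>d < 0\<close> the second signals undercoverage.
\<close>

lemma coverage_spike_kernel:
  fixes q :: ereal
  assumes a: "0 < \<alpha>" "\<alpha> < 1" and d: "\<bar>d\<bar> \<le> min \<alpha> (1 - \<alpha>) / 2"
    and S: "\<And>x y. S x y = max (\<alpha> / 2 - y) (y - (1 - \<alpha> / 2))"
  shows "0 \<le> q \<Longrightarrow> 1 - \<alpha> + d \<le> coverage (spike_kernel \<alpha> x1 d) S q x1"
    and "q < 0 \<Longrightarrow> coverage (spike_kernel \<alpha> x1 d) S q x1 \<le> 1 - \<alpha> + d"
proof -
  interpret prob_space "tilted_unif \<alpha> d" by (rule prob_space_tilted_unif[OF a d])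
  let ?C = "{\<alpha> / 2..1 - \<alpha> / 2}" and ?B = "{y. ereal (S x1 y) \<le> q}"
  have B: "?B \<in> sets borel" unfolding S by measurable
  have C: "?C = {y. S x1 y \<le> 0}" by (auto simp: S)
  have cov: "coverage (spike_kernel \<alpha> x1 d) S q x1 = measure (tilted_unif \<alpha> d) ?B"
    by (simp add: coverage_def spike_kernel_def)
  show "1 - \<alpha> + d \<le> coverage (spike_kernel \<alpha> x1 d) S q x1" if q: "0 \<le> q"
  proof -
    have "?C \<subseteq> ?B" unfolding C using q by (auto intro: order_trans[of _ 0])
    then have "measure (tilted_unif \<alpha> d) ?C \<le> measure (tilted_unif \<alpha> d) ?B"
      using B by (intro finite_measure_mono) auto
    then show ?thesis by (simp add: cov measure_tilted_unif_central[OF a d])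
  qed
  show "coverage (spike_kernel \<alpha> x1 d) S q x1 \<le> 1 - \<alpha> + d" if q: "q < 0"
  proof -
    have "?B \<subseteq> ?C" unfolding C using q
      by (auto dest: le_less_trans simp: zero_ereal_def)
    then have "measure (tilted_unif \<alpha> d) ?B \<le> measure (tilted_unif \<alpha> d) ?C"
      by (intro finite_measure_mono) auto
    then show ?thesis by (simp add: cov measure_tilted_unif_central[OF a d])
  qed
qed

lemma coverage_spike_kernel_measurable:
  assumes x1: "{x1} \<in> sets M" and S: "\<And>x y. S x y = (s y :: real)"
  shows "(\<lambda>x. coverage (spike_kernel \<alpha> x1 d) S q x - c) \<in> borel_measurable M"
proof -
  have "(\<lambda>x. coverage (spike_kernel \<alpha> x1 d) S q x - c)
    = (\<lambda>x. if x \<in> {x1} then measure (tilted_unif \<alpha> d) {y. ereal (s y) \<le> q} - c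
        else measure unif01 {y. ereal (s y) \<le> q} - c)"
    by (auto simp: coverage_def spike_kernel_def S)
  also have "\<dots> \<in> borel_measurable M" using x1 by measurable
  finally show ?thesis .
qed

text \<open>
  Le Cam's two-point argument. Under \<open>spike_kernel \<alpha> x1 d\<close> the rule loses at least \<open>d\<close> on the samples
  with \<open>q \<ge> 0\<close>, under \<open>spike_kernel \<alpha> x1 (- d)\<close> on the other samples. These two events are
  complementary under the reference sample law, which assigns them total mass \<open>1\<close>, and passing to
  the alternatives lowers each of the two probabilities by at most \<open>1 / 4\<close>.
\<close>

lemma minimax_risk_spike_ge:
  assumes a: "0 < \<alpha>" "\<alpha> < 1" and d: "0 \<le> d" "d \<le> min \<alpha> (1 - \<alpha>) / 2"
    and PX: "prob_space PX" and x1: "x1 \<in> space PX" "{x1} \<in> sets PX" and sQ: "sets M = sets PX"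
    and m: "(1 + d\<^sup>2 * measure PX {x1} / (\<alpha> * (1 - \<alpha>))) ^ m \<le> 5 / 4" and p: "1 \<le> p"
    and S: "\<And>x y. S x y = max (\<alpha> / 2 - y) (y - (1 - \<alpha> / 2))"
  shows "ennreal (d / 4) \<le> minimax_risk \<alpha> PX (return M x1) S m p"
  unfolding minimax_risk_def
proof (rule INF_greatest)
  fix q assume q: "q \<in> threshold_rules m PX"
  define R where "R P = (\<integral>\<^sup>+ z. Lp_norm p (return M x1) (\<lambda>x. coverage P S (q z) x - (1 - \<alpha>))
    \<partial>sample_law m PX P)" for P
  let ?N = "\<Pi>\<^sub>M i\<in>{..<m}. PX \<Otimes>\<^sub>M (borel :: real measure)"
  let ?K = "spike_kernel \<alpha> x1"
  define A where "A = {z \<in> space ?N. 0 \<le> q z}"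
  have qm[measurable]: "q \<in> borel_measurable ?N" using q by (simp add: threshold_rules_def)
  have A: "A \<in> sets ?N" "space ?N - A \<in> sets ?N" unfolding A_def by measurable
  have dp: "\<bar>d\<bar> \<le> min \<alpha> (1 - \<alpha>) / 2" and dm: "\<bar>- d\<bar> \<le> min \<alpha> (1 - \<alpha>) / 2" using d by auto
  have x1M: "x1 \<in> space M" "{x1} \<in> sets M" using x1 sQ sets_eq_imp_space_eq[OF sQ] by auto
  have loss: "ennreal d * indicator B z \<le> Lp_norm p (return M x1) (\<lambda>x. coverage (?K e) S (q z) x - (1 - \<alpha>))"
    if "z \<in> B \<Longrightarrow> d \<le> \<bar>coverage (?K e) S (q z) x1 - (1 - \<alpha>)\<bar>" for e z B
  proof (cases "z \<in> B")
    case True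
    have "ennreal d \<le> ennreal \<bar>coverage (?K e) S (q z) x1 - (1 - \<alpha>)\<bar>"
      using that[OF True] by (rule ennreal_leI)
    also have "\<dots> \<le> Lp_norm p (return M x1) (\<lambda>x. coverage (?K e) S (q z) x - (1 - \<alpha>))"
      by (intro Lp_norm_return x1M p
          coverage_spike_kernel_measurable[where s="\<lambda>y. max (\<alpha> / 2 - y) (y - (1 - \<alpha> / 2))"] S)
    finally show ?thesis using True by simp
  qed simp
  have risk: "ennreal (d * measure (sample_law m PX (?K e)) B) \<le> R (?K e)"
    if e: "\<bar>e\<bar> \<le> min \<alpha> (1 - \<alpha>) / 2" and B: "B \<in> sets ?N"
      and l: "\<And>z. z \<in> B \<Longrightarrow> d \<le> \<bar>coverage (?K e) S (q z) x1 - (1 - \<alpha>)\<bar>" for e B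
  proof -
    interpret prob_space "sample_law m PX (?K e)"
      by (rule sample_law_spike_kernel(2)[OF a e PX x1(2)])
    have B': "B \<in> sets (sample_law m PX (?K e))"
      using B by (simp add: sample_law_spike_kernel(1)[OF a e PX x1(2)])
    have "ennreal (d * measure (sample_law m PX (?K e)) B)
        = (\<integral>\<^sup>+ z. ennreal d * indicator B z \<partial>sample_law m PX (?K e))"
      using B' d by (simp add: nn_integral_cmult_indicator emeasure_eq_measure ennreal_mult)
    also have "\<dots> \<le> R (?K e)" unfolding R_def using l by (intro nn_integral_mono loss) auto
    finally show ?thesis .
  qed
  have Rp: "ennreal (d * measure (sample_law m PX (?K d)) A) \<le> R (?K d)"
  proof (rule risk[OF dp A(1)])
    fix z assume "z \<in> A"
    then show "d \<le> \<bar>coverage (?K d) S (q z) x1 - (1 - \<alpha>)\<bar>"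
      using coverage_spike_kernel(1)[where S=S and q="q z" and ?x1.0=x1, OF a dp S] by (simp add: A_def)
  qed
  have Rm: "ennreal (d * measure (sample_law m PX (?K (- d))) (space ?N - A)) \<le> R (?K (- d))"
  proof (rule risk[OF dm A(2)])
    fix z assume "z \<in> space ?N - A"
    then have "q z < 0" by (auto simp: A_def)
    then show "d \<le> \<bar>coverage (?K (- d)) S (q z) x1 - (1 - \<alpha>)\<bar>"
      using coverage_spike_kernel(2)[where S=S and q="q z" and ?x1.0=x1, OF a dm S] by simp
  qed
  let ?NU = "\<Pi>\<^sub>M i\<in>{..<m}. PX \<Otimes>\<^sub>M unif01"
  interpret PX: prob_space PX by fact
  interpret U: prob_space unif01 by (rule prob_space_unif01)
  interpret PU: pair_prob_space PX unif01 ..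
  interpret N0: prob_space ?NU by (intro prob_space_PiM PU.P.prob_space_axioms)
  have "sets (PX \<Otimes>\<^sub>M unif01) = sets (PX \<Otimes>\<^sub>M borel)"
    by (intro sets_pair_measure_cong) auto
  then have sN: "sets ?NU = sets ?N" by (simp cong: sets_PiM_cong)
  have compl: "measure ?NU (space ?N - A) = 1 - measure ?NU A"
    using N0.prob_compl[of A] A(1) sN sets_eq_imp_space_eq[OF sN] by simp
  have m': "(1 + (- d)\<^sup>2 * measure PX {x1} / (\<alpha> * (1 - \<alpha>))) ^ m \<le> 5 / 4" using m by simp
  have "1 / 2 \<le> measure (sample_law m PX (?K d)) A + measure (sample_law m PX (?K (- d))) (space ?N - A)"
    using sample_law_spike_kernel_ge[OF a dp PX x1(2) m A(1)]
      sample_law_spike_kernel_ge[OF a dm PX x1(2) m' A(2)] compl by linarith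
  then have "1 / 4 \<le> measure (sample_law m PX (?K d)) A
      \<or> 1 / 4 \<le> measure (sample_law m PX (?K (- d))) (space ?N - A)" by linarith
  then have "d / 4 \<le> d * measure (sample_law m PX (?K d)) A
      \<or> d / 4 \<le> d * measure (sample_law m PX (?K (- d))) (space ?N - A)"
    using mult_left_mono[OF _ d(1)] by force
  then have "ennreal (d / 4) \<le> R (?K d) \<or> ennreal (d / 4) \<le> R (?K (- d))"
    using Rp Rm by (auto intro: order_trans[OF ennreal_leI])
  moreover have "R (?K e) \<le> (SUP P\<in>admissible_kernels \<alpha> PX. R P)" if "\<bar>e\<bar> \<le> min \<alpha> (1 - \<alpha>) / 2" for e
    using a that PX x1 by (intro SUP_upper spike_kernel_admissible)
  ultimately show "ennreal (d / 4) \<le> (SUP P\<in>admissible_kernels \<alpha> PX.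
    \<integral>\<^sup>+ z. Lp_norm p (return M x1) (\<lambda>x. coverage P S (q z) x - (1 - \<alpha>)) \<partial>sample_law m PX P)"
    unfolding R_def[symmetric] using dp dm by (auto intro: order_trans)
qed

text \<open>
  The choice of \<open>d\<close> makes the second moment of the sample likelihood ratio \<open>(1 + ln 2 / (4 * m)) ^ m\<close>, which is
  at most \<open>2 powr (1 / 4)\<close> for every \<open>m\<close>. The condition on \<open>m\<close> is \<open>16 * d\<^sup>2 \<le> (min \<alpha> (1 - \<alpha>))\<^sup>2\<close>.
\<close>

lemma perturbation_size:
  fixes \<alpha> \<kappa> :: real and m :: nat
  assumes a: "0 < \<alpha>" "\<alpha> < 1" and k: "0 < \<kappa>"
    and m: "int m \<ge> \<lceil>4 * ln 2 * (1 + \<kappa>) * \<alpha> * (1 - \<alpha>) / (min \<alpha> (1 - \<alpha>))\<^sup>2\<rceil>"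
  defines "d \<equiv> sqrt (ln 2 * \<alpha> * (1 - \<alpha>)) * sqrt ((1 + \<kappa>) / real m) / 2"
  shows "0 \<le> d" and "d \<le> min \<alpha> (1 - \<alpha>) / 2"
    and "(1 + d\<^sup>2 * (1 / (1 + \<kappa>)) / (\<alpha> * (1 - \<alpha>))) ^ m \<le> 5 / 4"
proof -
  define \<mu> where "\<mu> = min \<alpha> (1 - \<alpha>)"
  have \<mu>: "0 < \<mu>" using a by (simp add: \<mu>_def)
  have pos: "0 < 4 * ln 2 * (1 + \<kappa>) * \<alpha> * (1 - \<alpha>) / \<mu>\<^sup>2" using a k \<mu> by simp
  have ge: "4 * ln 2 * (1 + \<kappa>) * \<alpha> * (1 - \<alpha>) / \<mu>\<^sup>2 \<le> real m"
    using m unfolding \<mu>_def[symmetric] by (simp add: ceiling_le_iff)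
  then have mpos: "0 < real m" using pos by linarith
  have dsq: "d\<^sup>2 = ln 2 * \<alpha> * (1 - \<alpha>) * ((1 + \<kappa>) / real m) / 4"
    unfolding d_def using a k by (simp add: power_mult_distrib power_divide)
  show "0 \<le> d" unfolding d_def using a k by simp
  have "4 * ln 2 * (1 + \<kappa>) * \<alpha> * (1 - \<alpha>) \<le> real m * \<mu>\<^sup>2" using ge \<mu> by (simp add: pos_divide_le_eq)
  then have "16 * d\<^sup>2 \<le> \<mu>\<^sup>2" unfolding dsq using mpos by (simp add: field_simps)
  then have "(4 * d)\<^sup>2 \<le> \<mu>\<^sup>2" by (simp add: power_mult_distrib)
  then have "4 * d \<le> \<mu>" by (rule power2_le_imp_le) (use \<mu> in simp)
  then show "d \<le> min \<alpha> (1 - \<alpha>) / 2" using \<open>0 \<le> d\<close> unfolding \<mu>_def[symmetric] by linarith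
  have e: "d\<^sup>2 * (1 / (1 + \<kappa>)) / (\<alpha> * (1 - \<alpha>)) = ln 2 / 4 / real m"
    unfolding dsq using a k mpos by (simp add: divide_simps)
  have "(1 + ln 2 / 4 / real m) ^ m \<le> exp (ln 2 / 4 / real m) ^ m"
    using mpos by (intro power_mono exp_ge_add_one_self add_nonneg_nonneg) auto
  also have "\<dots> = exp (ln 2 / 4)" using mpos by (simp add: exp_of_nat_mult[symmetric])
  also have "\<dots> \<le> 5 / 4"
  proof (rule power_le_imp_le_base[where n=3])
    have "exp (ln 2 / 4 :: real) ^ 4 = 2" by (simp add: exp_of_nat_mult[symmetric])
    then show "exp (ln 2 / 4 :: real) ^ Suc 3 \<le> (5 / 4) ^ Suc 3"
      by (simp add: eval_nat_numeral)
  qed simp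
  finally show "(1 + d\<^sup>2 * (1 / (1 + \<kappa>)) / (\<alpha> * (1 - \<alpha>))) ^ m \<le> 5 / 4" unfolding e .
qed

theorem theorem6:
  fixes M :: "'x measure" and \<alpha> \<kappa> :: real
  assumes "0 < \<alpha>" and "\<alpha> < 1" and "0 < \<kappa>"
    and "\<exists>x1\<in>space M. \<exists>x2\<in>space M. x1 \<noteq> x2 \<and> {x1} \<in> sets M \<and> {x2} \<in> sets M"
  shows "\<exists>(PX :: 'x measure) (QX :: 'x measure) (P0 :: 'x \<Rightarrow> real measure) (S :: 'x \<Rightarrow> real \<Rightarrow> real).
    prob_space PX \<and> sets PX = sets M \<and>
    prob_space QX \<and> sets QX = sets M \<and>
    P0 \<in> prob_kernel M \<and>
    absolutely_continuous PX QX \<and>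
    (\<exists>B::real. AE x in PX. RN_deriv PX QX x \<le> ennreal B) \<and>
    chi_square QX PX = ennreal \<kappa> \<and>
    mass_regular_ae \<alpha> PX P0 \<and>
    (\<forall>x\<in>space M. \<forall>y. S x y = cqr_score \<alpha> P0 x y) \<and>
    (\<forall>(m::nat) (p::ennreal).
       int m \<ge> \<lceil>4 * ln 2 * (1 + \<kappa>) * \<alpha> * (1 - \<alpha>) / (min \<alpha> (1 - \<alpha>))\<^sup>2\<rceil> \<longrightarrow> 1 \<le> p \<longrightarrow>
       minimax_risk \<alpha> PX QX S m p
         \<ge> ennreal (1 / 8 * sqrt (ln 2 * \<alpha> * (1 - \<alpha>)) * sqrt ((1 + \<kappa>) / real m)))"
proof -
  obtain x1 x2 where x: "x1 \<in> space M" "x2 \<in> space M" "x1 \<noteq> x2" "{x1} \<in> sets M"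
    using assms(4) by blast
  define p1 where "p1 = 1 / (1 + \<kappa>)"
  have p1: "0 < p1" "p1 \<le> 1" using assms(3) by (auto simp: p1_def)
  define PX where "PX = two_point M p1 x1 x2"
  define P0 where "P0 = spike_kernel \<alpha> x1 0"
  define S where "S = cqr_score \<alpha> P0"
  have PX: "prob_space PX" and sPX: "sets PX = sets M" "space PX = space M"
    unfolding PX_def using x by (auto intro: prob_space_two_point)
  have x1: "x1 \<in> space PX" "{x1} \<in> sets PX" using x sPX by auto
  have S: "S x y = max (\<alpha> / 2 - y) (y - (1 - \<alpha> / 2))" for x y
    unfolding S_def P0_def using assms(1,2) by (intro cqr_score_unif01) auto
  have P0: "P0 \<in> admissible_kernels \<alpha> PX"
    unfolding P0_def using assms(1,2) PX x1 by (intro spike_kernel_admissible) auto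
  have "P0 \<in> prob_kernel M"
    using P0 by (simp add: admissible_kernels_def prob_kernel_def measurable_cong_sets[OF sPX(1) refl])
  moreover have "absolutely_continuous PX (return M x1)"
    unfolding return_eq_density_two_point[OF x p1] PX_def using x(4)
    by (intro absolutely_continuousI_density) auto
  moreover have "AE z in PX. RN_deriv PX (return M x1) z \<le> ennreal (1 / p1)"
    unfolding PX_def using RN_deriv_two_point_return[OF x p1]
    by eventually_elim (auto simp: indicator_def)
  moreover have "chi_square (return M x1) PX = ennreal \<kappa>"
    unfolding PX_def p1_def by (rule chi_square_two_point_return[OF x assms(3)])
  moreover have "mass_regular_ae \<alpha> PX P0" using P0 by (simp add: admissible_kernels_def)
  moreover have "minimax_risk \<alpha> PX (return M x1) S m p
      \<ge> ennreal (1 / 8 * sqrt (ln 2 * \<alpha> * (1 - \<alpha>)) * sqrt ((1 + \<kappa>) / real m))"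
    if m: "int m \<ge> \<lceil>4 * ln 2 * (1 + \<kappa>) * \<alpha> * (1 - \<alpha>) / (min \<alpha> (1 - \<alpha>))\<^sup>2\<rceil>" and p: "1 \<le> p" for m p
  proof -
    note d = perturbation_size[OF assms(1-3) m]
    have "emeasure PX {x1} = (\<integral>\<^sup>+ z. indicator {x1} z \<partial>PX)" using x1 by simp
    also have "\<dots> = ennreal p1" unfolding PX_def using x p1 by (subst nn_integral_two_point) auto
    finally have "measure PX {x1} = 1 / (1 + \<kappa>)" using p1 by (simp add: measure_def p1_def)
    then show ?thesis
      using minimax_risk_spike_ge[OF assms(1,2) d(1,2) PX x1 sPX(1)[symmetric] _ p S, of m] d(3) by simp
  qed
  ultimately show ?thesis
    using PX sPX(1) prob_space_return[OF x(1)] unfolding S_def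
    by (intro exI[of _ PX] exI[of _ "return M x1"] exI[of _ P0] exI[of _ "cqr_score \<alpha> P0"]) auto
qed

end
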